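(* Let $a,d,u,v,q$ be complex parameters (generic, so no denominator vanishes). Let $K_4(n):=K(a,q^{-n},q^{1-n},d,a,u,v,q^2)$ and $K_4'(n):=K(aq,q^{-n},q^{1-n},d,aq,u,v,q^2)$, and put \[ P_r:=\frac{(aq,d,q^2u,q^2v,aq^3/u,aq^3/v;q^2)_r}{(aq^3/d,u,v,aq/u,aq/v,q^2;q^2)_r\,d^r}. \] (i) The sequences with $\alpha_0=\beta_0=1$, $\alpha_{2r-1}=0$ ($r\ge1$), \[ \alpha_{2r}=\frac{1-aq^{4r}}{1-a}\frac{(a,d,q^2u,q^2v,aq^2/u,aq^2/v;q^2)_r\,q^{2r^2-4r}a^r}{(aq^2/d,u,v,a/u,a/v,q^2;q^2)_r\,d^r},\qquad \beta_n=K_4(n)\frac{(aq/d;q^2)_n}{(aq;q^2)_n(aq/d,q;q)_n}, \] form a Bailey pair relative to $a$. (ii) The sequences with $\alpha_0=\beta_0=1$ and, for $r\ge0$, \[ \alpha_{2r}=P_r\,q^{2r^2-3r}a^r,\quad \alpha_{2r+1}=-P_r\,q^{2r^2+r+1}a^{r+1},\quad \beta_n=K_4'(n)\frac{(aq^2/d;q^2)_n}{(aq^2;q^2)_n(aq^2/d,q;q)_n}, \] form a Bailey pair relative to $a$. (iii) The sequences with $\alpha_0=\beta_0=1$ and, for $r\ge0$, \[ \alpha_{2r}=P_r\,q^{2r^2-r}a^r,\quad \alpha_{2r+1}=-P_r\,q^{2r^2-r}a^{r},\quad \beta_n=K_4'(n)\frac{(aq^2/d;q^2)_n\,q^n}{(aq^2;q^2)_n(aq^2/d,q;q)_n},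 \] form a Bailey pair relative to $a$.
   Context: Notation: $(x;q)_n=\prod_{k=0}^{n-1}(1-xq^k)$ and $(x_1,\dots,x_k;q)_n=(x_1;q)_n\cdots(x_k;q)_n$. A pair of sequences $(\alpha_n)_{n\ge0},(\beta_n)_{n\ge0}$ is a Bailey pair relative to $a$ if $\alpha_0=1$ and $\beta_n=\sum_{j=0}^{n}\frac{\alpha_j}{(q;q)_{n-j}(aq;q)_{n+j}}$ for all $n\ge0$. The function $K$: for complex $a,b,c,d,e,u,v$ and a base $p$, let $\sigma_1,\dots,\sigma_4$ be the elementary symmetric functions of $b,c,d,e$ and \[ K(a,b,c,d,e,u,v,p):=\frac{uv(\sigma_3-a\sigma_1)(p\sigma_3-a\sigma_1)a^2+(1-p)uv(a^2-\sigma_4)(a^2-\sigma_2a+\sigma_4)a+(u+v)(a+uv)(\sigma_3-a\sigma_1)(a^2-p\sigma_4)a+(u^2+a)(v^2+a)(a^2-\sigma_4)(a^2-p\sigma_4)}{(a^2-bcde)(a^2-bcde\,p)(1-u)(a-u)(1-v)(a-v)}. \] *)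

theory Defs
  imports Complex_Main
begin

definition qpoch :: "complex \<Rightarrow> complex \<Rightarrow> nat \<Rightarrow> complex" where
  "qpoch x q n = (\<Prod>k<n. 1 - x * q ^ k)"

definition qpochs :: "complex list \<Rightarrow> complex \<Rightarrow> nat \<Rightarrow> complex" where
  "qpochs xs q n = (\<Prod>x\<leftarrow>xs. qpoch x q n)"

definition bailey_pair ::
  "complex \<Rightarrow> complex \<Rightarrow> (nat \<Rightarrow> complex) \<Rightarrow> (nat \<Rightarrow> complex) \<Rightarrow> bool" where
  "bailey_pair q a \<alpha> \<beta> \<longleftrightarrow>
     \<alpha> 0 = 1 \<and>
     (\<forall>n. \<beta> n = (\<Sum>j\<le>n. \<alpha> j / (qpoch q q (n - j) * qpoch (a * q) q (n + j))))"

definition K_num ::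
  "complex \<Rightarrow> complex \<Rightarrow> complex \<Rightarrow> complex \<Rightarrow> complex \<Rightarrow> complex \<Rightarrow> complex \<Rightarrow> complex \<Rightarrow> complex"
where
  "K_num a b c d e u v p =
     (let \<sigma>1 = b + c + d + e;
          \<sigma>2 = b * c + b * d + b * e + c * d + c * e + d * e;
          \<sigma>3 = b * c * d + b * c * e + b * d * e + c * d * e;
          \<sigma>4 = b * c * d * e
      in u * v * (\<sigma>3 - a * \<sigma>1) * (p * \<sigma>3 - a * \<sigma>1) * a\<^sup>2
         + (1 - p) * u * v * (a\<^sup>2 - \<sigma>4) * (a\<^sup>2 - \<sigma>2 * a + \<sigma>4) * a
         + (u + v) * (a + u * v) * (\<sigma>3 - a * \<sigma>1) * (a\<^sup>2 - p * \<sigma>4) * a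
         + (u\<^sup>2 + a) * (v\<^sup>2 + a) * (a\<^sup>2 - \<sigma>4) * (a\<^sup>2 - p * \<sigma>4))"

definition K_den ::
  "complex \<Rightarrow> complex \<Rightarrow> complex \<Rightarrow> complex \<Rightarrow> complex \<Rightarrow> complex \<Rightarrow> complex \<Rightarrow> complex \<Rightarrow> complex"
where
  "K_den a b c d e u v p =
     (a\<^sup>2 - b * c * d * e) * (a\<^sup>2 - b * c * d * e * p) * (1 - u) * (a - u) * (1 - v) * (a - v)"

definition K ::
  "complex \<Rightarrow> complex \<Rightarrow> complex \<Rightarrow> complex \<Rightarrow> complex \<Rightarrow> complex \<Rightarrow> complex \<Rightarrow> complex \<Rightarrow> complex"
where
  "K a b c d e u v p = K_num a b c d e u v p / K_den a b c d e u v p"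

definition K4 :: "complex \<Rightarrow> complex \<Rightarrow> complex \<Rightarrow> complex \<Rightarrow> complex \<Rightarrow> nat \<Rightarrow> complex" where
  "K4 a d u v q n = K a (q powi (- int n)) (q powi (1 - int n)) d a u v (q\<^sup>2)"

definition K4' :: "complex \<Rightarrow> complex \<Rightarrow> complex \<Rightarrow> complex \<Rightarrow> complex \<Rightarrow> nat \<Rightarrow> complex" where
  "K4' a d u v q n = K (a * q) (q powi (- int n)) (q powi (1 - int n)) d (a * q) u v (q\<^sup>2)"

definition Pfac :: "complex \<Rightarrow> complex \<Rightarrow> complex \<Rightarrow> complex \<Rightarrow> complex \<Rightarrow> nat \<Rightarrow> complex" where
  "Pfac a d u v q r =
     qpochs [a * q, d, q\<^sup>2 * u, q\<^sup>2 * v, a * q ^ 3 / u, a * q ^ 3 / v] (q\<^sup>2) r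
     / (qpochs [a * q ^ 3 / d, u, v, a * q / u, a * q / v, q\<^sup>2] (q\<^sup>2) r * d ^ r)"

definition alpha_i :: "complex \<Rightarrow> complex \<Rightarrow> complex \<Rightarrow> complex \<Rightarrow> complex \<Rightarrow> nat \<Rightarrow> complex" where
  "alpha_i a d u v q n =
     (if even n then
        let r = n div 2 in
          (1 - a * q ^ (4 * r)) / (1 - a)
          * (qpochs [a, d, q\<^sup>2 * u, q\<^sup>2 * v, a * q\<^sup>2 / u, a * q\<^sup>2 / v] (q\<^sup>2) r
               * q powi (2 * (int r)\<^sup>2 - 4 * int r) * a ^ r)
          / (qpochs [a * q\<^sup>2 / d, u, v, a / u, a / v, q\<^sup>2] (q\<^sup>2) r * d ^ r)
      else 0)"

definition beta_i :: "complex \<Rightarrow> complex \<Rightarrow> complex \<Rightarrow> complex \<Rightarrow> complex \<Rightarrow> nat \<Rightarrow> complex" where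
  "beta_i a d u v q n =
     K4 a d u v q n * (qpoch (a * q / d) (q\<^sup>2) n
       / (qpoch (a * q) (q\<^sup>2) n * qpochs [a * q / d, q] q n))"

definition alpha_ii :: "complex \<Rightarrow> complex \<Rightarrow> complex \<Rightarrow> complex \<Rightarrow> complex \<Rightarrow> nat \<Rightarrow> complex" where
  "alpha_ii a d u v q n =
     (let r = n div 2 in
        if even n then Pfac a d u v q r * q powi (2 * (int r)\<^sup>2 - 3 * int r) * a ^ r
        else - Pfac a d u v q r * q ^ (2 * r\<^sup>2 + r + 1) * a ^ (r + 1))"

definition beta_ii :: "complex \<Rightarrow> complex \<Rightarrow> complex \<Rightarrow> complex \<Rightarrow> complex \<Rightarrow> nat \<Rightarrow> complex" where
  "beta_ii a d u v q n =
     K4' a d u v q n * (qpoch (a * q\<^sup>2 / d) (q\<^sup>2) n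
       / (qpoch (a * q\<^sup>2) (q\<^sup>2) n * qpochs [a * q\<^sup>2 / d, q] q n))"

definition alpha_iii :: "complex \<Rightarrow> complex \<Rightarrow> complex \<Rightarrow> complex \<Rightarrow> complex \<Rightarrow> nat \<Rightarrow> complex" where
  "alpha_iii a d u v q n =
     (let r = n div 2 in
        if even n then Pfac a d u v q r * q powi (2 * (int r)\<^sup>2 - int r) * a ^ r
        else - Pfac a d u v q r * q powi (2 * (int r)\<^sup>2 - int r) * a ^ r)"

definition beta_iii :: "complex \<Rightarrow> complex \<Rightarrow> complex \<Rightarrow> complex \<Rightarrow> complex \<Rightarrow> nat \<Rightarrow> complex" where
  "beta_iii a d u v q n =
     K4' a d u v q n * (qpoch (a * q\<^sup>2 / d) (q\<^sup>2) n * q ^ n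
       / (qpoch (a * q\<^sup>2) (q\<^sup>2) n * qpochs [a * q\<^sup>2 / d, q] q n))"

text \<open>
  Genericity of the parameters, spelled out as the non-vanishing of every denominator that
  occurs: in the arguments of the shifted factorials, in the negative powers of \<open>q\<close>, in the
  two sequences, and in the defining relation of a Bailey pair. The parameters are otherwise
  arbitrary complex numbers; as all sums are finite, no bound on \<open>q\<close> is needed.
  Parts (ii) and (iii) have the same denominators.
\<close>

definition generic_i :: "complex \<Rightarrow> complex \<Rightarrow> complex \<Rightarrow> complex \<Rightarrow> complex \<Rightarrow> bool" where
  "generic_i a d u v q \<longleftrightarrow>
     q \<noteq> 0 \<and> d \<noteq> 0 \<and> u \<noteq> 0 \<and> v \<noteq> 0 \<and> 1 - a \<noteq> 0 \<and>
     (\<forall>n. qpoch q q n \<noteq> 0 \<and> qpoch (a * q) q n \<noteq> 0) \<and>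
     (\<forall>r. qpochs [a * q\<^sup>2 / d, u, v, a / u, a / v, q\<^sup>2] (q\<^sup>2) r \<noteq> 0) \<and>
     (\<forall>n. qpoch (a * q) (q\<^sup>2) n \<noteq> 0 \<and> qpochs [a * q / d, q] q n \<noteq> 0) \<and>
     (\<forall>n. K_den a (q powi (- int n)) (q powi (1 - int n)) d a u v (q\<^sup>2) \<noteq> 0)"

definition generic_ii_iii :: "complex \<Rightarrow> complex \<Rightarrow> complex \<Rightarrow> complex \<Rightarrow> complex \<Rightarrow> bool" where
  "generic_ii_iii a d u v q \<longleftrightarrow>
     q \<noteq> 0 \<and> d \<noteq> 0 \<and> u \<noteq> 0 \<and> v \<noteq> 0 \<and>
     (\<forall>n. qpoch q q n \<noteq> 0 \<and> qpoch (a * q) q n \<noteq> 0) \<and>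
     (\<forall>r. qpochs [a * q ^ 3 / d, u, v, a * q / u, a * q / v, q\<^sup>2] (q\<^sup>2) r \<noteq> 0) \<and>
     (\<forall>n. qpoch (a * q\<^sup>2) (q\<^sup>2) n \<noteq> 0 \<and> qpochs [a * q\<^sup>2 / d, q] q n \<noteq> 0) \<and>
     (\<forall>n. K_den (a * q) (q powi (- int n)) (q powi (1 - int n)) d (a * q) u v (q\<^sup>2) \<noteq> 0)"

end

theory Submission
  imports Defs
begin

text \<open>
  Write \<open>X\<^sub>j = q\<^sup>-\<^sup>j + a q\<^sup>j\<close>. Since \<open>(1 - q\<^sup>n\<^sup>-\<^sup>j) (1 - a q\<^sup>n\<^sup>+\<^sup>j) = q\<^sup>n (X\<^sub>n - X\<^sub>j)\<close>, multiplying \<open>\<alpha>\<^sub>j\<close> by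
  \<open>X\<^sub>j - s\<close> replaces \<open>\<beta>\<^sub>n\<close> by \<open>(X\<^sub>n - s) \<beta>\<^sub>n - q\<^sup>-\<^sup>n \<beta>\<^sub>n\<^sub>-\<^sub>1\<close>. The factors of \<open>\<alpha>\<close> in (i) that involve \<open>u\<close> and \<open>v\<close>
  are, up to constants, \<open>X\<^sub>j - (u + a/u)\<close> and \<open>X\<^sub>j - (v + a/v)\<close>, and without them (i) is a Bailey pair
  with a product formula for \<open>\<beta>\<close> (a terminating very-well-poised 6-phi-5 sum in base \<open>q\<^sup>2\<close>), proved by
  telescoping. As \<open>\<beta>\<^sub>n\<^sub>-\<^sub>1 / \<beta>\<^sub>n\<close> is rational in \<open>q\<^sup>n\<close>, applying the rule twice gives \<open>\<beta>\<^sub>n\<close> times a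
  rational function, which is \<open>K\<^sub>4(n)\<close>. In (ii) and (iii) the terms of index \<open>2r\<close> and \<open>2r + 1\<close>
  combine to the term of index \<open>2r\<close> of (i) with \<open>a q\<close> in place of \<open>a\<close>, up to a factor \<open>q\<^sup>n\<close> in (iii).
\<close>

section \<open>Shifted factorials\<close>

lemma qpoch_0 [simp]: "qpoch x q 0 = 1"
  by (simp add: qpoch_def)

lemma qpoch_Suc: "qpoch x q (Suc n) = qpoch x q n * (1 - x * q ^ n)"
  by (simp add: qpoch_def)

lemma qpoch_Suc_shift: "qpoch x q (Suc n) = (1 - x) * qpoch (x * q) q n"
  unfolding qpoch_def prod.lessThan_Suc_shift by (simp add: mult.assoc)

lemma qpoch_shift_ratio: "(1 - x) * qpoch (x * q) q n = qpoch x q n * (1 - x * q ^ n)"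
  using qpoch_Suc[of x q n] qpoch_Suc_shift[of x q n] by simp

lemma qpoch_nonzero_factor:
  assumes "\<And>n. qpoch x q n \<noteq> 0"
  shows "1 - x * q ^ k \<noteq> 0"
  using assms[of "Suc k"] by (simp add: qpoch_Suc)

lemma qpochs_Nil [simp]: "qpochs [] q n = 1"
  and qpochs_Cons [simp]: "qpochs (x # xs) q n = qpoch x q n * qpochs xs q n"
  by (simp_all add: qpochs_def)

section \<open>The Bailey sum and multiplication by a weight\<close>

text \<open>An operator on arbitrary sequences, since weighted sequences need not satisfy
  \<open>\<alpha> 0 = 1\<close>.\<close>

definition bailey_sum :: "complex \<Rightarrow> complex \<Rightarrow> (nat \<Rightarrow> complex) \<Rightarrow> nat \<Rightarrow> complex" where
  "bailey_sum q a \<alpha> n = (\<Sum>j\<le>n. \<alpha> j / (qpoch q q (n - j) * qpoch (a * q) q (n + j)))"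

lemma bailey_sum_even_support:
  assumes "\<And>j. odd j \<Longrightarrow> \<alpha> j = 0"
  shows "bailey_sum q a \<alpha> n =
    (\<Sum>r\<le>n div 2. \<alpha> (2 * r) / (qpoch q q (n - 2 * r) * qpoch (a * q) q (n + 2 * r)))"
proof -
  have "bailey_sum q a \<alpha> n =
      (\<Sum>j\<in>(\<lambda>r. 2 * r) ` {..n div 2}. \<alpha> j / (qpoch q q (n - j) * qpoch (a * q) q (n + j)))"
    unfolding bailey_sum_def
  proof (rule sum.mono_neutral_right)
    show "\<forall>j\<in>{..n} - (\<lambda>r. 2 * r) ` {..n div 2}.
        \<alpha> j / (qpoch q q (n - j) * qpoch (a * q) q (n + j)) = 0"
    proof
      fix j assume j: "j \<in> {..n} - (\<lambda>r. 2 * r) ` {..n div 2}"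
      have "odd j"
      proof
        assume "even j"
        then obtain r where "j = 2 * r" by blast
        with j show False by auto
      qed
      then show "\<alpha> j / (qpoch q q (n - j) * qpoch (a * q) q (n + j)) = 0"
        by (simp add: assms)
    qed
  qed auto
  also have "\<dots> = (\<Sum>r\<le>n div 2. \<alpha> (2 * r) / (qpoch q q (n - 2 * r) * qpoch (a * q) q (n + 2 * r)))"
    by (subst sum.reindex) (auto simp: inj_on_def)
  finally show ?thesis .
qed

text \<open>The factor (1 - q^(n-j)) (1 - a q^(n+j)) is the quotient of the denominators at n and n
  - 1, so inserting it under the sum at n yields the sum at n - 1. The value 0 for n = 0 stands for
  an empty sum.\<close>

lemma bailey_sum_mult_weight:
  assumes q: "q \<noteq> 0"
    and nz: "\<And>k. qpoch q q k \<noteq> 0" "\<And>k. qpoch (a * q) q k \<noteq> 0"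
  shows "bailey_sum q a (\<lambda>j. \<alpha> j * (1 / q ^ j + a * q ^ j - s)) n =
    (1 / q ^ n + a * q ^ n - s) * bailey_sum q a \<alpha> n
    - (if n = 0 then 0 else bailey_sum q a \<alpha> (n - 1)) / q ^ n"
proof (cases n)
  case 0
  then show ?thesis by (simp add: bailey_sum_def)
next
  case (Suc m)
  define w where "w j = qpoch q q (n - j) * qpoch (a * q) q (n + j)" for j
  have lower: "\<alpha> j / (qpoch q q (m - j) * qpoch (a * q) q (m + j)) =
      \<alpha> j / w j * ((1 - q ^ (n - j)) * (1 - a * q ^ (n + j)))" if "j \<le> m" for j
  proof -
    have "w j = qpoch q q (m - j) * qpoch (a * q) q (m + j)
        * ((1 - q ^ (n - j)) * (1 - a * q ^ (n + j)))"
      using that Suc by (simp add: w_def Suc_diff_le qpoch_Suc)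
    moreover have "w j \<noteq> 0" by (simp add: w_def nz)
    ultimately show ?thesis by simp
  qed
  have fac: "(1 - q ^ (n - j)) * (1 - a * q ^ (n + j)) =
      q ^ n * ((1 / q ^ n + a * q ^ n) - (1 / q ^ j + a * q ^ j))" if "j \<le> n" for j
  proof -
    have "q ^ n = q ^ (n - j) * q ^ j" using that by (simp flip: power_add)
    then show ?thesis using q by (simp add: power_add field_simps)
  qed
  have "bailey_sum q a \<alpha> m = (\<Sum>j\<le>m. \<alpha> j / w j * ((1 - q ^ (n - j)) * (1 - a * q ^ (n + j))))"
    unfolding bailey_sum_def by (intro sum.cong) (auto simp: lower)
  \<comment> \<open>The term j = n may be added, since its factor 1 - q^0 is zero.\<close>
  also have "\<dots> = (\<Sum>j\<le>n. \<alpha> j / w j * ((1 - q ^ (n - j)) * (1 - a * q ^ (n + j))))"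
    by (simp add: Suc)
  also have "\<dots> = (\<Sum>j\<le>n. \<alpha> j / w j *
      (q ^ n * ((1 / q ^ n + a * q ^ n) - (1 / q ^ j + a * q ^ j))))"
    by (intro sum.cong) (auto simp: fac)
  finally have "bailey_sum q a \<alpha> m / q ^ n =
      (\<Sum>j\<le>n. \<alpha> j / w j * ((1 / q ^ n + a * q ^ n) - (1 / q ^ j + a * q ^ j)))"
    using q by (simp add: sum_divide_distrib)
  moreover have "bailey_sum q a (\<lambda>j. \<alpha> j * (1 / q ^ j + a * q ^ j - s)) n =
      (\<Sum>j\<le>n. (1 / q ^ n + a * q ^ n - s) * (\<alpha> j / w j)
        - \<alpha> j / w j * ((1 / q ^ n + a * q ^ n) - (1 / q ^ j + a * q ^ j)))"
    unfolding bailey_sum_def w_def by (intro sum.cong refl) (simp add: diff_divide_distrib algebra_simps)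
  moreover have "bailey_sum q a \<alpha> n = (\<Sum>j\<le>n. \<alpha> j / w j)"
    by (simp add: bailey_sum_def w_def)
  ultimately show ?thesis
    using Suc by (simp only: sum_subtractf sum_distrib_left) simp
qed

section \<open>The base pair and its certificate\<close>

text \<open>The part of \<open>alpha_i\<close> free of u and v, without the factor 1 - a q^(4r),
  which the certificate treats separately. The q^(-4r) of \<open>alpha_i\<close> is absent, as it
  comes from the two weights.\<close>

definition base_kernel :: "complex \<Rightarrow> complex \<Rightarrow> complex \<Rightarrow> nat \<Rightarrow> complex" where
  "base_kernel a d q r = qpoch a (q\<^sup>2) r * qpoch d (q\<^sup>2) r * q ^ (2 * r\<^sup>2) * a ^ r / (1 - a)
     / (qpoch (a * q\<^sup>2 / d) (q\<^sup>2) r * qpoch (q\<^sup>2) (q\<^sup>2) r * d ^ r)"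

definition base_term :: "complex \<Rightarrow> complex \<Rightarrow> complex \<Rightarrow> nat \<Rightarrow> nat \<Rightarrow> complex" where
  "base_term a d q n r = base_kernel a d q r / (qpoch q q (n - 2 * r) * qpoch (a * q) q (n + 2 * r))"

definition base_beta :: "complex \<Rightarrow> complex \<Rightarrow> complex \<Rightarrow> nat \<Rightarrow> complex" where
  "base_beta a d q n = qpoch (a * q / d) (q\<^sup>2) n
     / (qpoch (a * q) (q\<^sup>2) n * (qpoch (a * q / d) q n * qpoch q q n))"

text \<open>
  With \<open>x = q\<^sup>2\<^sup>r\<close> and \<open>Q = q\<^sup>n\<close>, this is the Wilf--Zeilberger certificate for the first-order
  recurrence in \<open>n\<close> of the base sum: the two products on the right are consecutive values
  of the antidifference in \<open>r\<close>.
\<close>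

lemma telescope_identity:
  fixes a d q x Q :: complex
  assumes "q \<noteq> 0" "d \<noteq> 0" "x \<noteq> 0"
  shows "(1 - a * x\<^sup>2) * ((1 - a * Q\<^sup>2 / q) * (1 - a * Q / d) * (1 - Q)
       - (1 - a * Q\<^sup>2 / (q * d)) * (1 - Q / x) * (1 - a * Q * x)) =
     Q / x * ((1 - x) * (1 - a * x / d) * (1 - a * Q * x / q) * (1 - a * Q * x)
        - (1 - a * x) * (1 - d * x) * (a / d) * (x - Q) * (x - Q / q))"
  using assms by (simp add: field_simps power2_eq_square)

section \<open>The rational identity that produces K\<close>

text \<open>With Q = q^n, \<open>\<rho>\<close> and \<open>\<rho>'\<close> are the ratios of
  \<open>base_beta\<close> at n - 1 to n and at n - 2 to n - 1. The bracket is the factor by which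
  two applications of the weight rule multiply \<open>base_beta\<close>.\<close>

lemma K_num_identity:
  fixes a d q u v Q D D' :: complex
  assumes "q \<noteq> 0" "d \<noteq> 0" "u \<noteq> 0" "v \<noteq> 0" "Q \<noteq> 0" "D \<noteq> 0" "D' \<noteq> 0"
    and D: "D = q * d - a * Q\<^sup>2" and D': "D' = q ^ 3 * d - a * Q\<^sup>2"
    and \<rho>: "\<rho> = (q - a * Q\<^sup>2) * (d - a * Q) * (1 - Q) / D"
    and \<rho>': "\<rho>' = (q ^ 3 - a * Q\<^sup>2) * (q * d - a * Q) * (q - Q) / (q\<^sup>2 * D')"
  shows "K_num a (1 / Q) (q / Q) d a u v (q\<^sup>2) * Q ^ 4 = a\<^sup>2 * u * v * D * D' *
    ((1 / Q + a * Q - (v + a / v)) * ((1 / Q + a * Q - (u + a / u)) - \<rho> / Q)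
     - ((q / Q + a * Q / q - (u + a / u)) - \<rho>' * q / Q) * \<rho> / Q)"
  \<comment> \<open>\<open>D\<close> and \<open>D'\<close> stay atomic while denominators are
    cleared; expanding them afterwards leaves a polynomial identity.\<close>
  unfolding \<rho> \<rho>' K_num_def Let_def
  by (simp add: divide_simps assms(1-7), simp only: D D', algebra)

text \<open>Divides \<open>K_num_identity\<close> by the denominator of K. The constant in front of
  K is the product of the two weights at j = 0.\<close>

lemma K_identity:
  fixes a d q u v Q :: complex
  defines "\<rho> \<equiv> \<lambda>Q. (1 - a * Q\<^sup>2 / q) * (1 - a * Q / d) * (1 - Q) / (1 - a * Q\<^sup>2 / (q * d))"
  assumes nz: "q \<noteq> 0" "d \<noteq> 0" "u \<noteq> 0" "v \<noteq> 0" "Q \<noteq> 0"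
    and K: "K_den a (1 / Q) (q / Q) d a u v (q\<^sup>2) \<noteq> 0"
  shows "1 - a * Q\<^sup>2 / (q * d) \<noteq> 0"
    and "(1 / Q + a * Q - (v + a / v)) * ((1 / Q + a * Q - (u + a / u)) - \<rho> Q / Q)
     - ((q / Q + a * Q / q - (u + a / u)) - \<rho> (Q / q) * q / Q) * \<rho> Q / Q
    = (1 - u) * (1 - a / u) * ((1 - v) * (1 - a / v)) * K a (1 / Q) (q / Q) d a u v (q\<^sup>2)"
proof -
  define D where "D = q * d - a * Q\<^sup>2"
  define D' where "D' = q ^ 3 * d - a * Q\<^sup>2"
  define U where "U = (1 - u) * (a - u) * (1 - v) * (a - v)"
  \<comment> \<open>With b = 1/Q, c = q/Q and e = a, the first two factors of \<open>K_den\<close>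
    are -a D / Q^2 and -a D' / Q^2, so its nonvanishing gives that of a, \<open>D\<close> and
    \<open>D'\<close>.\<close>
  have den: "K_den a (1 / Q) (q / Q) d a u v (q\<^sup>2) * Q ^ 4 = a\<^sup>2 * D * D' * U"
    using nz by (simp add: K_den_def D_def D'_def U_def field_simps) algebra
  with K nz have nz': "a \<noteq> 0" "D \<noteq> 0" "D' \<noteq> 0" "U \<noteq> 0"
    by (metis (no_types, lifting) mult_eq_0_iff power_eq_0_iff zero_eq_power2)+
  have E: "1 - a * Q\<^sup>2 / (q * d) = D / (q * d)"
    and E': "1 - a * (Q / q)\<^sup>2 / (q * d) = D' / (q ^ 3 * d)"
    using nz by (simp_all add: D_def D'_def field_simps power2_eq_square power3_eq_cube)
  show "1 - a * Q\<^sup>2 / (q * d) \<noteq> 0" using nz nz' by (simp add: E)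
  have "\<rho> Q = (q - a * Q\<^sup>2) * (d - a * Q) * (1 - Q) / D"
    unfolding \<rho>_def E using nz nz' by (simp add: divide_simps)
  moreover have "\<rho> (Q / q) = (q ^ 3 - a * Q\<^sup>2) * (q * d - a * Q) * (q - Q) / (q\<^sup>2 * D')"
    unfolding \<rho>_def E' using nz nz' by (simp add: divide_simps) algebra
  ultimately have num: "K_num a (1 / Q) (q / Q) d a u v (q\<^sup>2) * Q ^ 4 = a\<^sup>2 * u * v * D * D' *
    ((1 / Q + a * Q - (v + a / v)) * ((1 / Q + a * Q - (u + a / u)) - \<rho> Q / Q)
     - ((q / Q + a * Q / q - (u + a / u)) - \<rho> (Q / q) * q / Q) * \<rho> Q / Q)"
    (is "_ = _ * ?L")
    using nz nz' by (intro K_num_identity) (auto simp: D_def D'_def)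
  have "K a (1 / Q) (q / Q) d a u v (q\<^sup>2) =
      K_num a (1 / Q) (q / Q) d a u v (q\<^sup>2) * Q ^ 4 / (K_den a (1 / Q) (q / Q) d a u v (q\<^sup>2) * Q ^ 4)"
    using nz by (simp add: K_def)
  also have "\<dots> = u * v * ?L / U"
    unfolding num den using nz' by simp
  finally have "u * v * ?L = U * K a (1 / Q) (q / Q) d a u v (q\<^sup>2)"
    using nz' by (simp add: mult.commute)
  moreover have "U = u * v * ((1 - u) * (1 - a / u) * ((1 - v) * (1 - a / v)))"
    using nz by (simp add: U_def field_simps)
  ultimately show "?L = (1 - u) * (1 - a / u) * ((1 - v) * (1 - a / v)) * K a (1 / Q) (q / Q) d a u v (q\<^sup>2)"
    using nz by simp
qed

section \<open>Evaluation of the base sum by telescoping\<close>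

text \<open>Each shifted factorial gains its next factor, and 2 (r + 1)^2 - 2 r^2 = 4 r + 2 accounts
  for the power of q.\<close>

lemma base_kernel_Suc:
  assumes "q \<noteq> 0" "d \<noteq> 0" "1 - a * q\<^sup>2 / d * (q\<^sup>2) ^ r \<noteq> 0" "1 - q\<^sup>2 * (q\<^sup>2) ^ r \<noteq> 0"
  shows "base_kernel a d q (Suc r) * ((1 - q\<^sup>2 * (q\<^sup>2) ^ r) * (1 - a * q\<^sup>2 / d * (q\<^sup>2) ^ r)) =
    base_kernel a d q r * ((1 - a * (q\<^sup>2) ^ r) * (1 - d * (q\<^sup>2) ^ r) * (q\<^sup>2 * ((q\<^sup>2) ^ r)\<^sup>2) * (a / d))"
proof -
  have "2 * (Suc r)\<^sup>2 = 2 * r\<^sup>2 + (2 + 2 * r * 2)" by (simp add: power2_eq_square)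
  then have e: "q ^ (2 * (Suc r)\<^sup>2) = q ^ (2 * r\<^sup>2) * (q\<^sup>2 * ((q\<^sup>2) ^ r)\<^sup>2)"
    by (simp only: power_add power_mult)
  have cancel: "X * x * (Y * y) * (Z * z) * (a * A) / (1 - a) / (P * p * (S * s) * (d * T)) * (s * p) =
      X * Y * Z * A / (1 - a) / (P * S * T) * (x * y * z * (a / d))"
    if "p \<noteq> 0" "s \<noteq> 0" for X Y Z A P S T x y z p s
  proof -
    have "X * x * (Y * y) * (Z * z) * (a * A) / (1 - a) / (P * p * (S * s) * (d * T)) * (s * p) =
      (X * Y * Z * A * (x * y * z * a)) / (1 - a) / (P * S * T * d) * (s * p / (s * p))"
      unfolding times_divide_times_eq divide_divide_eq_left by (simp only: mult_ac times_divide_eq_left times_divide_eq_right)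
    then show ?thesis using that by simp
  qed
  show ?thesis
    unfolding base_kernel_def qpoch_Suc e power_Suc[of a] power_Suc[of d]
    by (rule cancel) (use assms in auto)
qed

text \<open>Matches the first product of \<open>telescope_identity\<close> at r + 1 with the second
  at r, which makes the sum over r telescope.\<close>

lemma base_term_Suc:
  assumes q: "q \<noteq> 0" and d: "d \<noteq> 0" and n: "2 * Suc r \<le> n"
    and nz: "\<And>k. qpoch q q k \<noteq> 0" "\<And>k. qpoch (a * q) q k \<noteq> 0"
    and nzd: "1 - a * q\<^sup>2 / d * (q\<^sup>2) ^ r \<noteq> 0" "1 - q\<^sup>2 * (q\<^sup>2) ^ r \<noteq> 0"
  defines "x \<equiv> (q\<^sup>2) ^ r" and "y \<equiv> (q\<^sup>2) ^ Suc r" and "Q \<equiv> q ^ n"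
  shows "base_term a d q n (Suc r) * (Q / y
      * ((1 - y) * (1 - a * y / d) * (1 - a * Q * y / q) * (1 - a * Q * y))) =
    base_term a d q n r * (Q / x
      * ((1 - a * x) * (1 - d * x) * (a / d) * (x - Q) * (x - Q / q)))"
proof -
  define k where "k = n - 2 * Suc r"
  have k: "n - 2 * r = Suc (Suc k)" "n - 2 * Suc r = k"
    using n by (auto simp: k_def)
  have x0: "x \<noteq> 0" using q by (simp add: x_def)
  have y: "y = q\<^sup>2 * x" by (simp add: x_def y_def)
  have "n = k + 2 + 2 * r" using k n by linarith
  then have Q: "Q = q ^ k * q\<^sup>2 * x"
    by (simp only: Q_def x_def power_add power_mult)
  have A: "qpoch q q (n - 2 * r) =
      qpoch q q (n - 2 * Suc r) * ((1 - Q / (q * x)) * (1 - Q / x))"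
    unfolding k qpoch_Suc using q x0 by (simp add: Q power2_eq_square mult_ac)
  have B: "qpoch (a * q) q (n + 2 * Suc r) =
      qpoch (a * q) q (n + 2 * r) * ((1 - a * Q * y / q) * (1 - a * Q * y))"
    using q by (simp add: qpoch_Suc Q_def y_def power_add power_mult mult_ac power2_eq_square
        power_mult_distrib)
  define L where "L = qpoch q q (n - 2 * Suc r)"
  define M where "M = qpoch (a * q) q (n + 2 * r)"
  have nz': "L \<noteq> 0" "M \<noteq> 0" "(1 - Q / (q * x)) * (1 - Q / x) \<noteq> 0"
      "(1 - a * Q * y / q) * (1 - a * Q * y) \<noteq> 0"
    using nz A B unfolding L_def M_def by (metis mult_eq_0_iff)+
  have cancel: "A * (B * C) / (S * C * T) = A * B / (S * T)" if "C \<noteq> 0" for A B C S T :: complex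
    using that by simp
  have kern: "base_kernel a d q (Suc r) * ((1 - y) * (1 - a * y / d)) =
      base_kernel a d q r * ((1 - a * x) * (1 - d * x) * (y * x) * (a / d))"
    using base_kernel_Suc[OF q d nzd] by (simp add: x_def y_def power2_eq_square mult_ac)
  have "base_term a d q n (Suc r) * (Q / y
      * ((1 - y) * (1 - a * y / d) * (1 - a * Q * y / q) * (1 - a * Q * y)))
    = base_kernel a d q (Suc r) * ((1 - y) * (1 - a * y / d)) * (Q / y) / (L * M)
      * ((1 - a * Q * y / q) * (1 - a * Q * y) / ((1 - a * Q * y / q) * (1 - a * Q * y)))"
    unfolding base_term_def B L_def[symmetric] M_def[symmetric]
    by (simp only: mult_ac times_divide_eq_left times_divide_eq_right divide_divide_eq_left)
  also have "\<dots> = base_kernel a d q r * ((1 - a * x) * (1 - d * x) * (y * x) * (a / d)) * (Q / y) / (L * M)"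
    unfolding kern divide_self[OF nz'(4)] mult_1_right ..
  also have "\<dots> = base_kernel a d q r * ((1 - a * x) * (1 - d * x) * (a / d)) * (Q / x) * x\<^sup>2 / (L * M)"
    using x0 q by (simp add: y power2_eq_square)
  \<comment> \<open>Restores the two factors by which \<open>qpoch q q (n - 2 * r)\<close> exceeds
    \<open>L\<close>; x^2 then turns them into (x - Q) (x - Q/q).\<close>
  also have "\<dots> = base_kernel a d q r * ((1 - a * x) * (1 - d * x) * (a / d)) * (Q / x)
      * (x\<^sup>2 * ((1 - Q / (q * x)) * (1 - Q / x))) / (L * ((1 - Q / (q * x)) * (1 - Q / x)) * M)"
    by (rule cancel[OF nz'(3), symmetric])
  also have "x\<^sup>2 * ((1 - Q / (q * x)) * (1 - Q / x)) = (x - Q) * (x - Q / q)"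
    using x0 q by (simp add: field_simps power2_eq_square)
  finally show ?thesis
    unfolding base_term_def A L_def M_def by (simp add: mult_ac)
qed

text \<open>Neighbouring products cancel by \<open>base_term_Suc\<close>, and the first product at r
  = 0 vanishes with its factor 1 - x. Only the second product at r = m survives.\<close>

lemma base_term_telescope:
  assumes q: "q \<noteq> 0" and d: "d \<noteq> 0"
    and nz: "\<And>k. qpoch q q k \<noteq> 0" "\<And>k. qpoch (a * q) q k \<noteq> 0"
    and nzd: "\<And>k. qpoch (a * q\<^sup>2 / d) (q\<^sup>2) k \<noteq> 0" "\<And>k. qpoch (q\<^sup>2) (q\<^sup>2) k \<noteq> 0"
    and m: "2 * m \<le> n"
  defines "x \<equiv> \<lambda>r. (q\<^sup>2) ^ r" and "Q \<equiv> q ^ n"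
  shows "(\<Sum>r\<le>m. base_term a d q n r * ((1 - a * (x r)\<^sup>2) *
        ((1 - a * Q\<^sup>2 / q) * (1 - a * Q / d) * (1 - Q)
         - (1 - a * Q\<^sup>2 / (q * d)) * (1 - Q / x r) * (1 - a * Q * x r)))) =
    - (base_term a d q n m * (Q / x m
        * ((1 - a * x m) * (1 - d * x m) * (a / d) * (x m - Q) * (x m - Q / q))))"
  using m
proof (induction m)
  case 0
  have "x 0 = 1" by (simp add: x_def)
  then show ?case
    using telescope_identity[OF q d, of "x 0" a Q] by simp
next
  case (Suc m)
  have x0: "x r \<noteq> 0" for r using q by (simp add: x_def)
  have "base_term a d q n (Suc m) * (Q / x (Suc m)
      * ((1 - x (Suc m)) * (1 - a * x (Suc m) / d) * (1 - a * Q * x (Suc m) / q) * (1 - a * Q * x (Suc m)))) =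
    base_term a d q n m * (Q / x m
      * ((1 - a * x m) * (1 - d * x m) * (a / d) * (x m - Q) * (x m - Q / q)))"
    unfolding x_def Q_def
    using qpoch_nonzero_factor[OF nzd(1)] qpoch_nonzero_factor[OF nzd(2)]
    by (intro base_term_Suc[OF q d Suc.prems nz])
  then show ?case
    using Suc by (simp only: sum.atMost_Suc telescope_identity[OF q d x0])
      (simp add: right_diff_distrib)
qed

definition base_alpha :: "complex \<Rightarrow> complex \<Rightarrow> complex \<Rightarrow> nat \<Rightarrow> complex" where
  "base_alpha a d q j =
     (if even j then (1 - a * ((q\<^sup>2) ^ (j div 2))\<^sup>2) * base_kernel a d q (j div 2) else 0)"

text \<open>The sum at n is rewritten over the index range of the sum at n + 1. The difference of
  the two sides is then one telescoping sum, whose boundary term vanishes.\<close>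

lemma base_sum_recurrence:
  fixes a d q :: complex and n :: nat
  assumes q: "q \<noteq> 0" and d: "d \<noteq> 0"
    and nz: "\<And>k. qpoch q q k \<noteq> 0" "\<And>k. qpoch (a * q) q k \<noteq> 0"
    and nzd: "\<And>k. qpoch (a * q\<^sup>2 / d) (q\<^sup>2) k \<noteq> 0" "\<And>k. qpoch (q\<^sup>2) (q\<^sup>2) k \<noteq> 0"
  defines "Q \<equiv> q ^ Suc n"
  shows "(1 - a * Q\<^sup>2 / q) * (1 - a * Q / d) * (1 - Q) * bailey_sum q a (base_alpha a d q) (Suc n) =
    (1 - a * Q\<^sup>2 / (q * d)) * bailey_sum q a (base_alpha a d q) n"
proof -
  define N where "N = Suc n"
  define S where "S = bailey_sum q a (base_alpha a d q)"
  define Y where "Y = 1 / Q + a * Q"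
  define c where "c = (1 - a * Q\<^sup>2 / q) * (1 - a * Q / d) * (1 - Q)"
  define e where "e = 1 - a * Q\<^sup>2 / (q * d)"
  define x where "x r = (q\<^sup>2) ^ r" for r :: nat
  define w where "w j = qpoch q q (N - j) * qpoch (a * q) q (N + j)" for j
  have Q0: "Q \<noteq> 0" using q by (simp add: Q_def)
  have x0: "x r \<noteq> 0" for r using q by (simp add: x_def)
  have Qn: "q ^ N = Q" by (simp add: N_def Q_def)
  \<comment> \<open>Taking s = X_N in the weight rule removes the sum at N and leaves the sum at N -
    1 = n.\<close>
  have prev: "S n = - Q * bailey_sum q a (\<lambda>j. base_alpha a d q j * (1 / q ^ j + a * q ^ j - Y)) N"
    using bailey_sum_mult_weight[OF q nz, of "base_alpha a d q" Y N] Q0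
    unfolding Qn by (simp add: Y_def S_def N_def)
  have "S N = (\<Sum>r\<le>N div 2. base_alpha a d q (2 * r) / w (2 * r))"
    unfolding S_def w_def by (rule bailey_sum_even_support) (simp add: base_alpha_def)
  moreover have "S n = - Q * (\<Sum>r\<le>N div 2. base_alpha a d q (2 * r) / w (2 * r) * (1 / x r + a * x r - Y))"
    unfolding prev by (subst bailey_sum_even_support) (simp_all add: base_alpha_def w_def x_def power_mult)
  ultimately have "c * S N - e * S n = (\<Sum>r\<le>N div 2. base_alpha a d q (2 * r) / w (2 * r) *
      (c + e * Q * (1 / x r + a * x r - Y)))"
    by (simp only: distrib_left sum.distrib) (simp add: sum_distrib_left sum_negf mult_ac)
  also have "\<dots> = (\<Sum>r\<le>N div 2. base_term a d q N r * ((1 - a * (x r)\<^sup>2) *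
      (c - e * (1 - Q / x r) * (1 - a * Q * x r))))"
  proof (intro sum.cong refl)
    fix r
    have "Q * (1 / x r + a * x r - Y) = - ((1 - Q / x r) * (1 - a * Q * x r))"
      using Q0 x0[of r] by (simp add: Y_def field_simps)
    then have "c + e * Q * (1 / x r + a * x r - Y) = c - e * (1 - Q / x r) * (1 - a * Q * x r)"
      by (simp add: mult.assoc)
    then show "base_alpha a d q (2 * r) / w (2 * r) * (c + e * Q * (1 / x r + a * x r - Y)) =
        base_term a d q N r * ((1 - a * (x r)\<^sup>2) * (c - e * (1 - Q / x r) * (1 - a * Q * x r)))"
      by (simp add: base_alpha_def base_term_def w_def x_def)
  qed
  also have "\<dots> = - (base_term a d q N (N div 2) * (Q / x (N div 2) * ((1 - a * x (N div 2)) *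
      (1 - d * x (N div 2)) * (a / d) * (x (N div 2) - Q) * (x (N div 2) - Q / q))))"
    using base_term_telescope[OF q d nz nzd, of "N div 2" N] unfolding Qn c_def e_def x_def by simp
  \<comment> \<open>At the top index q^(2r) is Q for even N and Q/q for odd N.\<close>
  also have "(x (N div 2) - Q) * (x (N div 2) - Q / q) = 0"
  proof (cases "even N")
    case True
    then have "x (N div 2) = Q" by (simp add: x_def flip: power_mult Qn)
    then show ?thesis by simp
  next
    case False
    then have "N = Suc (2 * (N div 2))" by simp
    then have "Q = q * x (N div 2)" unfolding x_def Qn[symmetric] by (metis power_Suc power_mult)
    then show ?thesis using q by simp
  qed
  then have "- (base_term a d q N (N div 2) * (Q / x (N div 2) * ((1 - a * x (N div 2)) *
      (1 - d * x (N div 2)) * (a / d) * (x (N div 2) - Q) * (x (N div 2) - Q / q)))) = 0"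
    by (simp add: mult.assoc)
  finally show ?thesis by (simp add: S_def c_def e_def N_def)
qed

text \<open>The coefficients are those of \<open>base_sum_recurrence\<close>; the second claim
  allows solving for the value at n + 1.\<close>

lemma base_beta_recurrence:
  fixes a d q :: complex and n :: nat
  assumes q: "q \<noteq> 0"
    and nz: "\<And>k. qpoch q q k \<noteq> 0" "\<And>k. qpoch (a * q) (q\<^sup>2) k \<noteq> 0" "\<And>k. qpoch (a * q / d) q k \<noteq> 0"
  defines "Q \<equiv> q ^ Suc n"
  shows "(1 - a * Q\<^sup>2 / q) * (1 - a * Q / d) * (1 - Q) * base_beta a d q (Suc n) =
      (1 - a * Q\<^sup>2 / (q * d)) * base_beta a d q n"
    and "(1 - a * Q\<^sup>2 / q) * (1 - a * Q / d) * (1 - Q) \<noteq> 0"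
proof -
  have "q\<^sup>2 ^ n * q\<^sup>2 = Q\<^sup>2" by (simp add: Q_def power_mult_distrib power2_eq_square flip: power_mult_distrib)
  then have e: "a * q * q\<^sup>2 ^ n = a * Q\<^sup>2 / q" "a * q / d * q\<^sup>2 ^ n = a * Q\<^sup>2 / (q * d)"
      "a * q / d * q ^ n = a * Q / d" "q * q ^ n = Q"
    using q by (auto simp: Q_def power2_eq_square field_simps)
  have f: "1 - a * Q\<^sup>2 / q \<noteq> 0" "1 - a * Q / d \<noteq> 0" "1 - Q \<noteq> 0"
    using qpoch_nonzero_factor[OF nz(2), of n] qpoch_nonzero_factor[OF nz(3), of n]
      qpoch_nonzero_factor[OF nz(1), of n] by (simp_all only: e) simp_all
  then show "(1 - a * Q\<^sup>2 / q) * (1 - a * Q / d) * (1 - Q) \<noteq> 0" by simp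
  have "X * (Y * Z) * (A * E / (B * X * (C * Y * (F * Z)))) = E * (A / (B * (C * F)))"
    if "X \<noteq> 0" "Y \<noteq> 0" "Z \<noteq> 0" for X Y Z A B C E F :: complex
    using that by simp
  from this[OF f] show "(1 - a * Q\<^sup>2 / q) * (1 - a * Q / d) * (1 - Q) * base_beta a d q (Suc n) =
      (1 - a * Q\<^sup>2 / (q * d)) * base_beta a d q n"
    unfolding base_beta_def qpoch_Suc e by (simp only: mult.assoc)
qed

text \<open>Both sides start at 1 and obey the same first-order recurrence with nonzero leading
  coefficient.\<close>

lemma base_bailey_sum:
  assumes q: "q \<noteq> 0" and d: "d \<noteq> 0" and a: "1 - a \<noteq> 0"
    and nz: "\<And>k. qpoch q q k \<noteq> 0" "\<And>k. qpoch (a * q) q k \<noteq> 0"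
    and nzd: "\<And>k. qpoch (a * q\<^sup>2 / d) (q\<^sup>2) k \<noteq> 0" "\<And>k. qpoch (q\<^sup>2) (q\<^sup>2) k \<noteq> 0"
    and nzb: "\<And>k. qpoch (a * q) (q\<^sup>2) k \<noteq> 0" "\<And>k. qpoch (a * q / d) q k \<noteq> 0"
  shows "bailey_sum q a (base_alpha a d q) n = base_beta a d q n"
proof (induction n)
  case 0
  show ?case
    using a by (simp add: bailey_sum_def base_alpha_def base_kernel_def base_beta_def)
next
  case (Suc n)
  show ?case
    using base_sum_recurrence[OF q d nz nzd, of n] base_beta_recurrence[OF q nz(1) nzb, of n] Suc
    by (metis mult_cancel_left)
qed

section \<open>The two weights and the pair in (i)\<close>

text \<open>The weight rule is applied for u, then for v; \<open>\<rho>\<close> expresses the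
  earlier values of \<open>base_beta\<close> through the one at n, and \<open>K_identity\<close>
  evaluates the resulting factor.\<close>

lemma bailey_sum_twice_weighted_base:
  assumes nz0: "q \<noteq> 0" "d \<noteq> 0" "u \<noteq> 0" "v \<noteq> 0" "1 - a \<noteq> 0"
    and nz: "\<And>k. qpoch q q k \<noteq> 0" "\<And>k. qpoch (a * q) q k \<noteq> 0"
    and nzd: "\<And>k. qpoch (a * q\<^sup>2 / d) (q\<^sup>2) k \<noteq> 0" "\<And>k. qpoch (q\<^sup>2) (q\<^sup>2) k \<noteq> 0"
    and nzb: "\<And>k. qpoch (a * q) (q\<^sup>2) k \<noteq> 0" "\<And>k. qpoch (a * q / d) q k \<noteq> 0"
    and K: "\<And>n. K_den a (1 / q ^ n) (q / q ^ n) d a u v (q\<^sup>2) \<noteq> 0"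
  shows "bailey_sum q a (\<lambda>j. base_alpha a d q j
        * (1 / q ^ j + a * q ^ j - (u + a / u)) * (1 / q ^ j + a * q ^ j - (v + a / v))) n =
    (1 - u) * (1 - a / u) * ((1 - v) * (1 - a / v))
      * K a (1 / q ^ n) (q / q ^ n) d a u v (q\<^sup>2) * base_beta a d q n"
proof -
  define \<rho> where "\<rho> Q = (1 - a * Q\<^sup>2 / q) * (1 - a * Q / d) * (1 - Q) / (1 - a * Q\<^sup>2 / (q * d))" for Q
  define B where "B = base_beta a d q"
  have S: "bailey_sum q a (base_alpha a d q) = B"
    unfolding B_def by (rule ext, rule base_bailey_sum) (use assms in auto)
  \<comment> \<open>At n = 0 the factor 1 - Q of \<open>\<rho>\<close> vanishes, so one formula
    covers both cases of the weight rule.\<close>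
  have prev: "(if n = 0 then 0 else B (n - 1)) = B n * \<rho> (q ^ n)" for n
  proof (cases n)
    case (Suc m)
    have "1 - a * (q ^ n)\<^sup>2 / (q * d) \<noteq> 0"
      by (rule K_identity(1)[of q d u v]) (use K nz0 in auto)
    then show ?thesis
      using base_beta_recurrence(1)[OF nz0(1) nz(1) nzb, of m]
      by (simp add: Suc \<rho>_def B_def divide_simps mult_ac)
  qed (simp add: \<rho>_def)
  define B' where "B' = bailey_sum q a (\<lambda>j. base_alpha a d q j * (1 / q ^ j + a * q ^ j - (u + a / u)))"
  have B': "B' n = B n * (1 / q ^ n + a * q ^ n - (u + a / u) - \<rho> (q ^ n) / q ^ n)" for n
    unfolding B'_def bailey_sum_mult_weight[OF nz0(1) nz] S prev by (simp add: algebra_simps)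
  have prev': "(if n = 0 then 0 else B' (n - 1)) =
    B n * \<rho> (q ^ n) * (q / q ^ n + a * q ^ n / q - (u + a / u) - \<rho> (q ^ n / q) * q / q ^ n)"
  proof (cases n)
    case 0
    then show ?thesis by (simp add: \<rho>_def)
  next
    case (Suc m)
    then have "q ^ (n - 1) = q ^ n / q" using nz0 by simp
    moreover have "B (n - 1) = B n * \<rho> (q ^ n)" using prev[of n] Suc by simp
    ultimately show ?thesis using Suc nz0 B'[of "n - 1"] by simp
  qed
  have "bailey_sum q a (\<lambda>j. base_alpha a d q j
        * (1 / q ^ j + a * q ^ j - (u + a / u)) * (1 / q ^ j + a * q ^ j - (v + a / v))) n =
    B n * ((1 / q ^ n + a * q ^ n - (v + a / v)) * ((1 / q ^ n + a * q ^ n - (u + a / u)) - \<rho> (q ^ n) / q ^ n)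
     - ((q / q ^ n + a * q ^ n / q - (u + a / u)) - \<rho> (q ^ n / q) * q / q ^ n) * \<rho> (q ^ n) / q ^ n)"
    unfolding bailey_sum_mult_weight[OF nz0(1) nz] B'_def[symmetric] prev' B'[of n]
    by (simp add: right_diff_distrib[of "B n"] mult_ac)
  also have "\<dots> = B n * ((1 - u) * (1 - a / u) * ((1 - v) * (1 - a / v)) * K a (1 / q ^ n) (q / q ^ n) d a u v (q\<^sup>2))"
    unfolding \<rho>_def by (subst K_identity(2)) (use K nz0 in auto)
  finally show ?thesis by (simp add: B_def mult_ac)
qed

text \<open>At x = q^j these are the factors that the shifted factorials in u and a/u contribute to
  \<open>alpha_i\<close>.\<close>

lemma weight_factorization:
  fixes a u x :: complex
  assumes "u \<noteq> 0" "x \<noteq> 0"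
  shows "1 / x + a * x - (u + a / u) = (1 - u * x) * (1 - a / u * x) / x"
  using assms by (simp add: field_simps)

lemma qpoch_shift:
  assumes "1 - x \<noteq> 0"
  shows "qpoch (x * q) q n = qpoch x q n * (1 - x * q ^ n) / (1 - x)"
  using qpoch_shift_ratio[of x q n] assms by (simp add: field_simps)

text \<open>With x = q^(2r) = q^j, (q^2 u; q^2)_r / (u; q^2)_r = (1 - u x) / (1 - u), and likewise
  for v, a/u and a/v. The four quotients form the two weights over their values at j = 0, and
  q^(-4r) = 1/x^2 supplies the denominators of the weights.\<close>

lemma alpha_i_weighted_base:
  assumes nz: "q \<noteq> 0" "u \<noteq> 0" "v \<noteq> 0"
    and nzr: "\<And>r. qpochs [a * q\<^sup>2 / d, u, v, a / u, a / v, q\<^sup>2] (q\<^sup>2) r \<noteq> 0"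
  shows "alpha_i a d u v q j = base_alpha a d q j
        * (1 / q ^ j + a * q ^ j - (u + a / u)) * (1 / q ^ j + a * q ^ j - (v + a / v))
      / ((1 - u) * (1 - a / u) * ((1 - v) * (1 - a / v)))"
proof (cases "even j")
  case True
  then obtain r where j: "j = 2 * r" by blast
  define x where "x = (q\<^sup>2) ^ r"
  have x0: "x \<noteq> 0" using nz by (simp add: x_def)
  have qj: "q ^ j = x" by (simp add: j x_def power_mult)
  have x2: "q ^ (4 * r) = x\<^sup>2" by (simp add: x_def flip: power_mult)
  have "int (2 * r\<^sup>2) = 2 * (int r)\<^sup>2" "int (4 * r) = 4 * int r" by simp_all
  then have e: "q powi (2 * (int r)\<^sup>2 - 4 * int r) = q ^ (2 * r\<^sup>2) / x\<^sup>2"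
    unfolding x2[symmetric] using nz by (metis power_int_diff power_int_of_nat)
  have ne: "1 - u \<noteq> 0" "1 - v \<noteq> 0" "1 - a / u \<noteq> 0" "1 - a / v \<noteq> 0"
    using nzr[of 1] by (auto simp: qpoch_def)
  have shift: "qpoch (q\<^sup>2 * u) (q\<^sup>2) r = qpoch u (q\<^sup>2) r * (1 - u * x) / (1 - u)"
      "qpoch (q\<^sup>2 * v) (q\<^sup>2) r = qpoch v (q\<^sup>2) r * (1 - v * x) / (1 - v)"
      "qpoch (a * q\<^sup>2 / u) (q\<^sup>2) r = qpoch (a / u) (q\<^sup>2) r * (1 - a / u * x) / (1 - a / u)"
      "qpoch (a * q\<^sup>2 / v) (q\<^sup>2) r = qpoch (a / v) (q\<^sup>2) r * (1 - a / v * x) / (1 - a / v)"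
    using qpoch_shift[OF ne(1), of "q\<^sup>2" r] qpoch_shift[OF ne(2), of "q\<^sup>2" r]
      qpoch_shift[OF ne(3), of "q\<^sup>2" r] qpoch_shift[OF ne(4), of "q\<^sup>2" r]
    by (simp_all add: x_def mult.commute)
  have nzq: "qpoch u (q\<^sup>2) r \<noteq> 0" "qpoch v (q\<^sup>2) r \<noteq> 0" "qpoch (a / u) (q\<^sup>2) r \<noteq> 0" "qpoch (a / v) (q\<^sup>2) r \<noteq> 0"
    using nzr[of r] by auto
  have cancel: "Z / (1 - a) * (A * (D * (U * u1 / u2 * (V * v1 / v2 * (U' * u1' / u2' * (V' * v1' / v2' * 1))))) * (E / x\<^sup>2) * aa)
        / (W * (U * (V * (U' * (V' * (P * 1))))) * dd) =
      Z * (A * D * E * aa / (1 - a) / (W * P * dd)) * (u1 * u1' / x) * (v1 * v1' / x) / (u2 * u2' * (v2 * v2'))"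
    if "U \<noteq> 0" "V \<noteq> 0" "U' \<noteq> 0" "V' \<noteq> 0"
    for Z A D U V U' V' u1 v1 u1' v1' u2 v2 u2' v2' E aa W P dd :: complex
  proof -
    have "Z / (1 - a) * (A * (D * (U * u1 / u2 * (V * v1 / v2 * (U' * u1' / u2' * (V' * v1' / v2' * 1))))) * (E / x\<^sup>2) * aa)
        / (W * (U * (V * (U' * (V' * (P * 1))))) * dd) =
      Z * (A * D * E * aa / (1 - a) / (W * P * dd)) * (u1 * u1' / x) * (v1 * v1' / x) / (u2 * u2' * (v2 * v2'))
        * ((U * inverse U) * (V * inverse V) * (U' * inverse U') * (V' * inverse V'))"
      by (simp only: divide_inverse inverse_mult_distrib power2_eq_square mult_ac mult_1_right mult_1_left)
    then show ?thesis using that by simp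
  qed
  show ?thesis
    unfolding qj weight_factorization[OF nz(2) x0] weight_factorization[OF nz(3) x0]
    using True cancel[OF nzq]
    by (simp only: alpha_i_def base_alpha_def base_kernel_def if_True Let_def qpochs_Cons qpochs_Nil
        shift e x2 j nonzero_mult_div_cancel_left x_def[symmetric])
qed (simp add: alpha_i_def base_alpha_def)

text \<open>Dividing the twice weighted base sequence by \<open>c\<close> gives
  \<open>alpha_i\<close>; the same \<open>c\<close> stands in front of K in its sum and
  cancels.\<close>

lemma beta_i_eq_bailey_sum:
  assumes "generic_i a d u v q"
  shows "beta_i a d u v q n = bailey_sum q a (alpha_i a d u v q) n"
proof -
  have nz0: "q \<noteq> 0" "d \<noteq> 0" "u \<noteq> 0" "v \<noteq> 0" "1 - a \<noteq> 0"
    and nz: "\<And>k. qpoch q q k \<noteq> 0" "\<And>k. qpoch (a * q) q k \<noteq> 0"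
    and nzr: "\<And>r. qpochs [a * q\<^sup>2 / d, u, v, a / u, a / v, q\<^sup>2] (q\<^sup>2) r \<noteq> 0"
    and nzb: "\<And>k. qpoch (a * q) (q\<^sup>2) k \<noteq> 0" "\<And>k. qpoch (a * q / d) q k \<noteq> 0"
    and Kd: "\<And>n. K_den a (q powi (- int n)) (q powi (1 - int n)) d a u v (q\<^sup>2) \<noteq> 0"
    using assms by (auto simp: generic_i_def)
  have pw: "q powi (- int n) = 1 / q ^ n" "q powi (1 - int n) = q / q ^ n" for n
    using nz0 by (simp_all add: power_int_minus power_int_diff divide_inverse)
  have nzd: "\<And>k. qpoch (a * q\<^sup>2 / d) (q\<^sup>2) k \<noteq> 0" "\<And>k. qpoch (q\<^sup>2) (q\<^sup>2) k \<noteq> 0"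
    using nzr by auto
  define c where "c = (1 - u) * (1 - a / u) * ((1 - v) * (1 - a / v))"
  have c: "c \<noteq> 0"
    using nzr[of 1] by (auto simp: qpoch_def c_def)
  have "bailey_sum q a (alpha_i a d u v q) n = bailey_sum q a (\<lambda>j. base_alpha a d q j
        * (1 / q ^ j + a * q ^ j - (u + a / u)) * (1 / q ^ j + a * q ^ j - (v + a / v))) n / c"
    unfolding bailey_sum_def alpha_i_weighted_base[OF nz0(1,3,4) nzr] sum_divide_distrib c_def
    by (simp only: divide_divide_eq_left mult_ac)
  also have "\<dots> = c * K a (1 / q ^ n) (q / q ^ n) d a u v (q\<^sup>2) * base_beta a d q n / c"
    using bailey_sum_twice_weighted_base[OF nz0 nz nzd nzb Kd[unfolded pw]] by (simp only: c_def)
  also have "\<dots> = beta_i a d u v q n"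
    unfolding beta_i_def K4_def pw base_beta_def qpochs_Cons qpochs_Nil using c by simp
  finally show ?thesis by simp
qed

section \<open>Passage from a q to a and the pairs in (ii) and (iii)\<close>

lemma sum_lessThan_double: "(\<Sum>j<2 * m. f j) = (\<Sum>r<m. f (2 * r) + f (2 * r + 1 :: nat))"
  for f :: "nat \<Rightarrow> 'a::comm_monoid_add"
  by (induction m) (simp_all add: add.assoc)

text \<open>The terms 2r and 2r + 1 share the denominator (q; q)_(n-2r) (a q; q)_(n+2r+1), which is
  1 - a q times the denominator relative to a q at index 2r. Thus \<open>pair\<close> is an equality
  of numerators.\<close>

lemma bailey_sum_pair_terms:
  assumes nz: "\<And>k. qpoch q q k \<noteq> 0" "\<And>k. qpoch (a * q) q k \<noteq> 0"
    and odd: "\<And>j. odd j \<Longrightarrow> \<alpha>' j = 0"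
    and pair: "\<And>r. 2 * r \<le> n \<Longrightarrow>
      \<alpha> (2 * r) * (1 - a * q * q ^ (n + 2 * r)) + \<alpha> (2 * r + 1) * (1 - q ^ (n - 2 * r)) =
        c * (\<alpha>' (2 * r) * (1 - a * q))"
  shows "bailey_sum q a \<alpha> n = c * bailey_sum q (a * q) \<alpha>' n"
proof -
  define f where "f j = (if j \<le> n then \<alpha> j / (qpoch q q (n - j) * qpoch (a * q) q (n + j)) else 0)" for j
  have "bailey_sum q a \<alpha> n = (\<Sum>j\<le>n. f j)"
    by (simp add: bailey_sum_def f_def)
  \<comment> \<open>The range is completed to an even number of terms; \<open>f\<close> is 0 beyond
    n.\<close>
  also have "\<dots> = (\<Sum>j<2 * Suc (n div 2). f j)"
    by (rule sum.mono_neutral_left) (auto simp: f_def)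
  also have "\<dots> = (\<Sum>r\<le>n div 2. f (2 * r) + f (2 * r + 1))"
    unfolding sum_lessThan_double lessThan_Suc_atMost ..
  also have "\<dots> = (\<Sum>r\<le>n div 2. c *
      (\<alpha>' (2 * r) / (qpoch q q (n - 2 * r) * qpoch (a * q * q) q (n + 2 * r))))"
  proof (intro sum.cong refl)
    fix r assume "r \<in> {..n div 2}"
    then have r: "2 * r \<le> n" by auto
    define L M N y z where "L = qpoch q q (n - 2 * r)" and "M = qpoch (a * q) q (n + 2 * r)"
      and "N = qpoch (a * q * q) q (n + 2 * r)"
      and "y = 1 - a * q * q ^ (n + 2 * r)" and "z = 1 - q ^ (n - 2 * r)"
    have My: "M * y = (1 - a * q) * N"
      using qpoch_shift_ratio[of "a * q" q "n + 2 * r"] by (simp add: M_def N_def y_def)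
    have M1: "qpoch (a * q) q (n + (2 * r + 1)) = M * y"
      by (simp add: M_def y_def qpoch_Suc)
    have ne: "L \<noteq> 0" "M \<noteq> 0" "y \<noteq> 0"
      using nz qpoch_nonzero_factor[OF nz(2), of "n + 2 * r"] by (auto simp: L_def M_def y_def)
    have a1: "1 - a * q \<noteq> 0" using nz(2)[of 1] by (simp add: qpoch_def)
    \<comment> \<open>For 2r = n the index 2r + 1 is out of range, which agrees with z = 0.\<close>
    have "f (2 * r + 1) = \<alpha> (2 * r + 1) * z / (L * (M * y))"
    proof (cases "2 * r = n")
      case True
      then show ?thesis by (simp add: f_def z_def)
    next
      case False
      with r have "Suc (n - (2 * r + 1)) = n - 2 * r" by simp
      then have L: "L = qpoch q q (n - (2 * r + 1)) * z"
        by (metis L_def z_def qpoch_Suc power_Suc)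
      then have "z \<noteq> 0" using ne by auto
      then show ?thesis using r False by (simp add: f_def M1[simplified] L)
    qed
    moreover have "f (2 * r) = \<alpha> (2 * r) * y / (L * (M * y))"
      using r ne by (simp add: f_def L_def M_def)
    ultimately have "f (2 * r) + f (2 * r + 1) = (\<alpha> (2 * r) * y + \<alpha> (2 * r + 1) * z) / (L * (M * y))"
      by (simp add: add_divide_distrib)
    also have "\<dots> = c * (\<alpha>' (2 * r) * (1 - a * q)) / (L * ((1 - a * q) * N))"
      unfolding My using pair[OF r] by (simp add: y_def z_def)
    also have "\<dots> = c * (\<alpha>' (2 * r) / (L * N))"
      using a1 by simp
    finally show "f (2 * r) + f (2 * r + 1) = c *
        (\<alpha>' (2 * r) / (qpoch q q (n - 2 * r) * qpoch (a * q * q) q (n + 2 * r)))"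
      by (simp add: L_def N_def)
  qed
  also have "\<dots> = c * bailey_sum q (a * q) \<alpha>' n"
    by (simp add: bailey_sum_even_support[OF odd] sum_distrib_left)
  finally show ?thesis .
qed

text \<open>Apart from rewriting products, 1 - a q is (a q; q)_1, and (a q^2; q)_k divides (a q;
  q)_(k+1).\<close>

lemma generic_ii_iii_imp_generic_i:
  assumes "generic_ii_iii a d u v q"
  shows "generic_i (a * q) d u v q"
proof -
  have nz: "qpoch (a * q) q k \<noteq> 0" for k
    using assms by (simp add: generic_ii_iii_def)
  have "1 - a * q \<noteq> 0" using nz[of 1] by (simp add: qpoch_def)
  moreover have e: "a * q * q\<^sup>2 = a * q ^ 3" "a * q * q = a * q\<^sup>2"
    by (simp_all add: power2_eq_square power3_eq_cube)
  moreover have "qpoch (a * q\<^sup>2) q k \<noteq> 0" for k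
    using nz[of "Suc k"] by (simp add: qpoch_Suc_shift e)
  ultimately show ?thesis
    using assms unfolding generic_i_def e by (simp add: generic_ii_iii_def)
qed

lemma alpha_i_eq_Pfac:
  assumes "1 - a * q \<noteq> 0" "q \<noteq> 0"
  shows "alpha_i (a * q) d u v q (2 * r) * (1 - a * q) =
    Pfac a d u v q r * (1 - a * q ^ (4 * r + 1)) * (q powi (2 * (int r)\<^sup>2 - 4 * int r) * q ^ r * a ^ r)"
  using assms
  by (simp add: alpha_i_def Pfac_def power_mult_distrib power2_eq_square power3_eq_cube mult_ac)

lemma beta_ii_eq_beta_i: "beta_ii a d u v q n = beta_i (a * q) d u v q n"
  by (simp add: beta_ii_def beta_i_def K4_def K4'_def power2_eq_square mult.assoc)

lemma beta_iii_eq_beta_i: "beta_iii a d u v q n = q ^ n * beta_i (a * q) d u v q n"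
  by (simp add: beta_iii_def beta_i_def K4_def K4'_def power2_eq_square mult_ac)

text \<open>Part (i) with a q for a is carried back to a by \<open>bailey_sum_pair_terms\<close>,
  with c = 1 for (ii) and c = q^n for (iii).\<close>

lemma beta_ii_iii_eq_bailey_sum:
  assumes "generic_ii_iii a d u v q"
  shows "beta_ii a d u v q n = bailey_sum q a (alpha_ii a d u v q) n"
    and "beta_iii a d u v q n = bailey_sum q a (alpha_iii a d u v q) n"
proof -
  have q: "q \<noteq> 0" and nz: "\<And>k. qpoch q q k \<noteq> 0" "\<And>k. qpoch (a * q) q k \<noteq> 0"
    using assms by (auto simp: generic_ii_iii_def)
  have a1: "1 - a * q \<noteq> 0" using nz(2)[of 1] by (simp add: qpoch_def)
  have odd: "\<And>j. odd j \<Longrightarrow> alpha_i (a * q) d u v q j = 0" by (simp add: alpha_i_def)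
  \<comment> \<open>\<open>E r\<close> is q^(2r^2-3r), in the form in which
    \<open>alpha_i_eq_Pfac\<close> contains it; the other exponents exceed this one by 2r and 4r +
    1.\<close>
  define E where "E r = q powi (2 * (int r)\<^sup>2 - 4 * int r) * q ^ r" for r
  have E3: "q powi (2 * (int r)\<^sup>2 - 3 * int r) = E r" for r
    using q by (simp add: E_def flip: power_int_of_nat power_int_add)
  have E1: "q powi (2 * (int r)\<^sup>2 - int r) = E r * q ^ (2 * r)" for r
    using q by (simp add: E_def flip: power_int_of_nat power_int_add)
  have E5: "q ^ (2 * r\<^sup>2 + r + 1) = E r * q ^ (4 * r + 1)" for r
  proof -
    have split: "q powi (m + int i + int k) = q powi m * q ^ i * q ^ k" for m i k
      using q by (simp add: power_int_add)
    have "int (2 * r\<^sup>2 + r + 1) = 2 * (int r)\<^sup>2 - 4 * int r + int r + int (4 * r + 1)"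
      by simp
    then show ?thesis
      unfolding E_def split[symmetric] by (metis power_int_of_nat)
  qed
  note \<alpha>i = alpha_i_eq_Pfac[OF a1 q, folded E_def]
  have "bailey_sum q a (alpha_ii a d u v q) n = 1 * bailey_sum q (a * q) (alpha_i (a * q) d u v q) n"
  proof (rule bailey_sum_pair_terms[OF nz odd])
    fix r assume "2 * r \<le> n"
    then obtain k where n: "n = 2 * r + k" by (auto simp: le_iff_add)
    have q4: "q ^ (4 * r) = (q ^ (2 * r))\<^sup>2" by (simp flip: power_mult)
    have "alpha_ii a d u v q (2 * r) = Pfac a d u v q r * E r * a ^ r"
      "alpha_ii a d u v q (2 * r + 1) = - Pfac a d u v q r * (E r * q ^ (4 * r + 1)) * a ^ (r + 1)"
      by (simp_all only: alpha_ii_def E3 E5[symmetric]) simp_all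
    \<comment> \<open>(1 - a q^(n+2r+1)) - a q^(4r+1) (1 - q^(n-2r)) = 1 - a q^(4r+1).\<close>
    then show "alpha_ii a d u v q (2 * r) * (1 - a * q * q ^ (n + 2 * r))
        + alpha_ii a d u v q (2 * r + 1) * (1 - q ^ (n - 2 * r)) =
      1 * (alpha_i (a * q) d u v q (2 * r) * (1 - a * q))"
      unfolding \<alpha>i by (simp add: n power_add q4 power2_eq_square algebra_simps)
  qed simp_all
  then show "beta_ii a d u v q n = bailey_sum q a (alpha_ii a d u v q) n"
    using beta_i_eq_bailey_sum[OF generic_ii_iii_imp_generic_i[OF assms]] by (simp add: beta_ii_eq_beta_i)
  have "bailey_sum q a (alpha_iii a d u v q) n = q ^ n * bailey_sum q (a * q) (alpha_i (a * q) d u v q) n"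
  proof (rule bailey_sum_pair_terms[OF nz odd])
    fix r assume "2 * r \<le> n"
    then obtain k where n: "n = 2 * r + k" by (auto simp: le_iff_add)
    have q4: "q ^ (4 * r) = (q ^ (2 * r))\<^sup>2" by (simp flip: power_mult)
    have "alpha_iii a d u v q (2 * r) = Pfac a d u v q r * (E r * q ^ (2 * r)) * a ^ r"
      "alpha_iii a d u v q (2 * r + 1) = - Pfac a d u v q r * (E r * q ^ (2 * r)) * a ^ r"
      by (simp_all only: alpha_iii_def E1[symmetric]) simp_all
    \<comment> \<open>q^(2r) ((1 - a q^(n+2r+1)) - (1 - q^(n-2r))) = q^n (1 - a q^(4r+1)).\<close>
    then show "alpha_iii a d u v q (2 * r) * (1 - a * q * q ^ (n + 2 * r))
        + alpha_iii a d u v q (2 * r + 1) * (1 - q ^ (n - 2 * r)) =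
      q ^ n * (alpha_i (a * q) d u v q (2 * r) * (1 - a * q))"
      unfolding \<alpha>i by (simp add: n power_add q4 power2_eq_square algebra_simps)
  qed simp_all
  then show "beta_iii a d u v q n = bailey_sum q a (alpha_iii a d u v q) n"
    using beta_i_eq_bailey_sum[OF generic_ii_iii_imp_generic_i[OF assms]] by (simp add: beta_iii_eq_beta_i)
qed

text \<open>At n = 0 the sum is \<open>\<alpha> 0\<close> over empty products, which gives
  \<open>\<beta> 0 = 1\<close> without evaluating K.\<close>

lemma bailey_pairI:
  assumes "\<alpha> 0 = 1" "\<And>n. \<beta> n = bailey_sum q a \<alpha> n"
  shows "\<alpha> 0 = 1 \<and> \<beta> 0 = 1 \<and> bailey_pair q a \<alpha> \<beta>"
  using assms by (simp add: bailey_pair_def bailey_sum_def)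

theorem theorem2p10:
  fixes a d u v q :: complex
  shows "(generic_i a d u v q \<longrightarrow>
            alpha_i a d u v q 0 = 1 \<and> beta_i a d u v q 0 = 1 \<and>
            bailey_pair q a (alpha_i a d u v q) (beta_i a d u v q))
       \<and> (generic_ii_iii a d u v q \<longrightarrow>
            alpha_ii a d u v q 0 = 1 \<and> beta_ii a d u v q 0 = 1 \<and>
            bailey_pair q a (alpha_ii a d u v q) (beta_ii a d u v q))
       \<and> (generic_ii_iii a d u v q \<longrightarrow>
            alpha_iii a d u v q 0 = 1 \<and> beta_iii a d u v q 0 = 1 \<and>
            bailey_pair q a (alpha_iii a d u v q) (beta_iii a d u v q))"
proof (intro conjI[of "_ \<longrightarrow> _"] impI)
  assume "generic_i a d u v q"
  then show "alpha_i a d u v q 0 = 1 \<and> beta_i a d u v q 0 = 1 \<and>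
      bailey_pair q a (alpha_i a d u v q) (beta_i a d u v q)"
    by (intro bailey_pairI beta_i_eq_bailey_sum) (simp_all add: alpha_i_def generic_i_def)
next
  assume "generic_ii_iii a d u v q"
  then show "alpha_ii a d u v q 0 = 1 \<and> beta_ii a d u v q 0 = 1 \<and>
      bailey_pair q a (alpha_ii a d u v q) (beta_ii a d u v q)"
    by (intro bailey_pairI beta_ii_iii_eq_bailey_sum) (simp_all add: alpha_ii_def Pfac_def)
next
  assume "generic_ii_iii a d u v q"
  then show "alpha_iii a d u v q 0 = 1 \<and> beta_iii a d u v q 0 = 1 \<and>
      bailey_pair q a (alpha_iii a d u v q) (beta_iii a d u v q)"
    by (intro bailey_pairI beta_ii_iii_eq_bailey_sum) (simp_all add: alpha_iii_def Pfac_def)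
qed

end
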